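(* Every small diagram in $\mathbf{Cnct}$, every small diagram in $\mathbf{Cnc}$ and every finite diagram in $\mathbf{fCnct}$ has a limit and a colimit, described as follows. Let $D:\mathbf{I}\to\mathbf{C}$ be such a diagram, where $\mathbf{C}$ is $\mathbf{Cnct}$, $\mathbf{Cnc}$ or $\mathbf{fCnct}$ (with $\mathbf{I}$ small in the first two cases and finite in the last). (1) The colimit $C$ of $D$ has as carrier the colimit $(c_i:|D_i|\to|C|)_{i\in\mathbf{I}}$ of the underlying diagram of sets, and its connectivity structure is $$\kappa(C)=[\{c_i(K): i\in\mathbf{I},\ K\in\kappa(D_i)\}]$$ if $\mathbf{C}$ is $\mathbf{Cnct}$ or $\mathbf{fCnct}$, and $$\kappa(C)=[\{c_i(K): i\in\mathbf{I},\ K\in\kappa(D_i)\}]_0$$ if $\mathbf{C}=\mathbf{Cnc}$; the coprojections are the $c_i$. (2) The limit $L$ of $D$ has as carrier the limit $(l_i:|L|\to|D_i|)_{i\in\mathbf{I}}$ of the underlying diagram of sets, and its connectivity structure is $$\kappa(L)=\bigcap_{i\in\mathbf{I}}\{K\subseteq|L| : l_i(K)\in\kappa(D_i)\};$$ the projections are the $l_i$.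
   Context: A connectivity structure on a set $X$ is a set $\mathcal{K}$ of subsets of $X$ with $\emptyset\in\mathcal{K}$ such that for every $\mathcal{I}\subseteq\mathcal{K}$, if $\bigcap_{K\in\mathcal{I}}K\neq\emptyset$ then $\bigcup_{K\in\mathcal{I}}K\in\mathcal{K}$. It is integral if it contains every singleton. A connectivity space $X=(|X|,\kappa(X))$ is a set $|X|$ (the carrier) with a connectivity structure $\kappa(X)$ on it, whose elements are the connected subsets; it is integral if $\kappa(X)$ is, and finite if $|X|$ is finite. A connectivity morphism $X\to Y$ is a function $f:|X|\to|Y|$ with $f(K)\in\kappa(Y)$ for all $K\in\kappa(X)$. $\mathbf{Cnc}$, $\mathbf{Cnct}$, $\mathbf{fCnct}$ are the categories of connectivity spaces, integral connectivity spaces and finite integral connectivity spaces respectively, with connectivity morphisms. For a set $\mathcal{A}$ of subsets of a set $X$, $[\mathcal{A}]_0$ (resp. $[\mathcal{A}]$) denotes the smallest (for inclusion) connectivity structure (resp. integral connectivity structure) on $X$ containing $\mathcal{A}$. An intersection over an empty index set of sets of subsets of $|L|$ is the set of all subsets of $|L|$. *)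

theory Defs
  imports Main "HOL-Library.FuncSet"
begin

section \<open>Connectivity spaces\<close>

definition connectivity_structure :: "'x set \<Rightarrow> 'x set set \<Rightarrow> bool" where
  "connectivity_structure X \<K> \<longleftrightarrow>
     \<K> \<subseteq> Pow X \<and> {} \<in> \<K> \<and> (\<forall>\<I>\<subseteq>\<K>. \<Inter>\<I> \<noteq> {} \<longrightarrow> \<Union>\<I> \<in> \<K>)"

definition integral_connectivity_structure :: "'x set \<Rightarrow> 'x set set \<Rightarrow> bool" where
  "integral_connectivity_structure X \<K> \<longleftrightarrow>
     connectivity_structure X \<K> \<and> (\<forall>x\<in>X. {x} \<in> \<K>)"

definition generated0 :: "'x set \<Rightarrow> 'x set set \<Rightarrow> 'x set set" where
  "generated0 X \<A> = (LEAST \<K>. connectivity_structure X \<K> \<and> \<A> \<subseteq> \<K>)"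

definition generated :: "'x set \<Rightarrow> 'x set set \<Rightarrow> 'x set set" where
  "generated X \<A> = (LEAST \<K>. integral_connectivity_structure X \<K> \<and> \<A> \<subseteq> \<K>)"

text \<open>Both least elements exist as soon as the generators are subsets of the carrier.\<close>

lemma connectivity_structure_Inter:
  assumes "\<S> \<noteq> {}" and S: "\<And>\<K>. \<K> \<in> \<S> \<Longrightarrow> connectivity_structure X \<K>"
  shows "connectivity_structure X (\<Inter>\<S>)"
  unfolding connectivity_structure_def
proof (intro conjI allI impI)
  show "\<Inter>\<S> \<subseteq> Pow X" "{} \<in> \<Inter>\<S>"
    using assms by (auto simp: connectivity_structure_def)
next
  fix \<I> assume "\<I> \<subseteq> \<Inter>\<S>" "\<Inter>\<I> \<noteq> {}"
  then have "\<Union>\<I> \<in> \<K>" if "\<K> \<in> \<S>" for \<K>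
    using S[OF that] that unfolding connectivity_structure_def by (meson Inter_lower subset_trans)
  then show "\<Union>\<I> \<in> \<Inter>\<S>" by blast
qed

lemma connectivity_structure_Pow: "connectivity_structure X (Pow X)"
  by (auto simp: connectivity_structure_def)

lemma generated0_least:
  assumes "\<A> \<subseteq> Pow X"
  shows "connectivity_structure X (generated0 X \<A>)" "\<A> \<subseteq> generated0 X \<A>"
    and "\<And>\<K>. connectivity_structure X \<K> \<Longrightarrow> \<A> \<subseteq> \<K> \<Longrightarrow> generated0 X \<A> \<subseteq> \<K>"
proof -
  let ?S = "{\<K>. connectivity_structure X \<K> \<and> \<A> \<subseteq> \<K>}"
  have "connectivity_structure X (\<Inter>?S)"
    using assms connectivity_structure_Pow[of X] by (intro connectivity_structure_Inter) auto
  moreover have "generated0 X \<A> = \<Inter>?S"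
    unfolding generated0_def by (rule Least_equality) (use calculation in auto)
  ultimately show "connectivity_structure X (generated0 X \<A>)" "\<A> \<subseteq> generated0 X \<A>"
    and "\<And>\<K>. connectivity_structure X \<K> \<Longrightarrow> \<A> \<subseteq> \<K> \<Longrightarrow> generated0 X \<A> \<subseteq> \<K>"
    by auto
qed

lemma generated_least:
  assumes "\<A> \<subseteq> Pow X"
  shows "integral_connectivity_structure X (generated X \<A>)" "\<A> \<subseteq> generated X \<A>"
    and "\<And>\<K>. integral_connectivity_structure X \<K> \<Longrightarrow> \<A> \<subseteq> \<K> \<Longrightarrow> generated X \<A> \<subseteq> \<K>"
proof -
  let ?S = "{\<K>. integral_connectivity_structure X \<K> \<and> \<A> \<subseteq> \<K>}"
  have "connectivity_structure X (\<Inter>?S)"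
    using assms connectivity_structure_Pow[of X]
    by (intro connectivity_structure_Inter) (auto simp: integral_connectivity_structure_def)
  then have "integral_connectivity_structure X (\<Inter>?S)"
    by (auto simp: integral_connectivity_structure_def)
  moreover have "generated X \<A> = \<Inter>?S"
    unfolding generated_def by (rule Least_equality) (use calculation in auto)
  ultimately show "integral_connectivity_structure X (generated X \<A>)" "\<A> \<subseteq> generated X \<A>"
    and "\<And>\<K>. integral_connectivity_structure X \<K> \<Longrightarrow> \<A> \<subseteq> \<K> \<Longrightarrow> generated X \<A> \<subseteq> \<K>"
    by auto
qed

record 'x cspace =
  pts :: "'x set"
  conn :: "'x set set"

text \<open>Functions between sets are extensional, so that equality of morphisms is equality in HOL
  and composition is \<^const>\<open>compose\<close>.\<close>

definition cmorphisms :: "'x cspace \<Rightarrow> 'y cspace \<Rightarrow> ('x \<Rightarrow> 'y) set" where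
  "cmorphisms X Y = {f \<in> pts X \<rightarrow>\<^sub>E pts Y. \<forall>K\<in>conn X. f ` K \<in> conn Y}"

text \<open>Names of the three full categories. Their objects range over spaces on every type, so the
  object predicate has to be polymorphic and the categories themselves are passed by name.\<close>

datatype cnc_category = Cnc | Cnct | fCnct

fun is_object :: "cnc_category \<Rightarrow> 'x cspace \<Rightarrow> bool" where
  "is_object Cnc X \<longleftrightarrow> connectivity_structure (pts X) (conn X)"
| "is_object Cnct X \<longleftrightarrow> integral_connectivity_structure (pts X) (conn X)"
| "is_object fCnct X \<longleftrightarrow> integral_connectivity_structure (pts X) (conn X) \<and> finite (pts X)"


section \<open>Index categories and diagrams\<close>

record ('i, 'a) icat =
  Obj :: "'i set"
  Arr :: "'a set"
  src :: "'a \<Rightarrow> 'i"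
  tgt :: "'a \<Rightarrow> 'i"
  ident :: "'i \<Rightarrow> 'a"
  comp :: "'a \<Rightarrow> 'a \<Rightarrow> 'a"  \<comment> \<open>\<open>comp \<I> g f\<close> is \<open>g\<close> after \<open>f\<close>\<close>

definition small_category :: "('i, 'a) icat \<Rightarrow> bool" where
  "small_category \<I> \<longleftrightarrow>
     (\<forall>a\<in>Arr \<I>. src \<I> a \<in> Obj \<I> \<and> tgt \<I> a \<in> Obj \<I>) \<and>
     (\<forall>i\<in>Obj \<I>. ident \<I> i \<in> Arr \<I> \<and> src \<I> (ident \<I> i) = i \<and> tgt \<I> (ident \<I> i) = i) \<and>
     (\<forall>f\<in>Arr \<I>. \<forall>g\<in>Arr \<I>. src \<I> g = tgt \<I> f \<longrightarrow>
        comp \<I> g f \<in> Arr \<I> \<and> src \<I> (comp \<I> g f) = src \<I> f \<and> tgt \<I> (comp \<I> g f) = tgt \<I> g) \<and>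
     (\<forall>f\<in>Arr \<I>. comp \<I> f (ident \<I> (src \<I> f)) = f \<and> comp \<I> (ident \<I> (tgt \<I> f)) f = f) \<and>
     (\<forall>f\<in>Arr \<I>. \<forall>g\<in>Arr \<I>. \<forall>h\<in>Arr \<I>. src \<I> g = tgt \<I> f \<longrightarrow> src \<I> h = tgt \<I> g \<longrightarrow>
        comp \<I> h (comp \<I> g f) = comp \<I> (comp \<I> h g) f)"

definition finite_category :: "('i, 'a) icat \<Rightarrow> bool" where
  "finite_category \<I> \<longleftrightarrow> small_category \<I> \<and> finite (Obj \<I>) \<and> finite (Arr \<I>)"

abbreviation carriers :: "('i \<Rightarrow> 'x cspace) \<Rightarrow> 'i \<Rightarrow> 'x set" where
  "carriers D \<equiv> \<lambda>i. pts (D i)"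

text \<open>A diagram is a functor, with object part \<open>D\<close> and arrow part \<open>F\<close>.\<close>

definition diagram ::
  "cnc_category \<Rightarrow> ('i, 'a) icat \<Rightarrow> ('i \<Rightarrow> 'x cspace) \<Rightarrow> ('a \<Rightarrow> 'x \<Rightarrow> 'x) \<Rightarrow> bool" where
  "diagram C \<I> D F \<longleftrightarrow>
     (\<forall>i\<in>Obj \<I>. is_object C (D i)) \<and>
     (\<forall>a\<in>Arr \<I>. F a \<in> cmorphisms (D (src \<I> a)) (D (tgt \<I> a))) \<and>
     (\<forall>i\<in>Obj \<I>. F (ident \<I> i) = (\<lambda>x\<in>pts (D i). x)) \<and>
     (\<forall>f\<in>Arr \<I>. \<forall>g\<in>Arr \<I>. src \<I> g = tgt \<I> f \<longrightarrow>
        F (comp \<I> g f) = compose (pts (D (src \<I> f))) (F g) (F f))"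


section \<open>Limits and colimits of sets\<close>

text \<open>The universal properties below quantify over test objects carried by a type \<open>'t\<close>; a statement
  that is polymorphic in \<open>'t\<close> expresses the property for all test objects.\<close>

definition set_cone ::
  "('i, 'a) icat \<Rightarrow> ('i \<Rightarrow> 'x set) \<Rightarrow> ('a \<Rightarrow> 'x \<Rightarrow> 'x) \<Rightarrow> 'l set \<Rightarrow> ('i \<Rightarrow> 'l \<Rightarrow> 'x) \<Rightarrow> bool" where
  "set_cone \<I> S F L l \<longleftrightarrow>
     (\<forall>i\<in>Obj \<I>. l i \<in> L \<rightarrow>\<^sub>E S i) \<and>
     (\<forall>a\<in>Arr \<I>. compose L (F a) (l (src \<I> a)) = l (tgt \<I> a))"

definition set_limit ::
  "'t itself \<Rightarrow> ('i, 'a) icat \<Rightarrow> ('i \<Rightarrow> 'x set) \<Rightarrow> ('a \<Rightarrow> 'x \<Rightarrow> 'x) \<Rightarrow>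
   'l set \<Rightarrow> ('i \<Rightarrow> 'l \<Rightarrow> 'x) \<Rightarrow> bool" where
  "set_limit _ \<I> S F L l \<longleftrightarrow>
     set_cone \<I> S F L l \<and>
     (\<forall>(T :: 't set) t. set_cone \<I> S F T t \<longrightarrow>
        (\<exists>!u. u \<in> T \<rightarrow>\<^sub>E L \<and> (\<forall>i\<in>Obj \<I>. compose T (l i) u = t i)))"

definition set_cocone ::
  "('i, 'a) icat \<Rightarrow> ('i \<Rightarrow> 'x set) \<Rightarrow> ('a \<Rightarrow> 'x \<Rightarrow> 'x) \<Rightarrow> 'c set \<Rightarrow> ('i \<Rightarrow> 'x \<Rightarrow> 'c) \<Rightarrow> bool" where
  "set_cocone \<I> S F Q c \<longleftrightarrow>
     (\<forall>i\<in>Obj \<I>. c i \<in> S i \<rightarrow>\<^sub>E Q) \<and>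
     (\<forall>a\<in>Arr \<I>. compose (S (src \<I> a)) (c (tgt \<I> a)) (F a) = c (src \<I> a))"

definition set_colimit ::
  "'t itself \<Rightarrow> ('i, 'a) icat \<Rightarrow> ('i \<Rightarrow> 'x set) \<Rightarrow> ('a \<Rightarrow> 'x \<Rightarrow> 'x) \<Rightarrow>
   'c set \<Rightarrow> ('i \<Rightarrow> 'x \<Rightarrow> 'c) \<Rightarrow> bool" where
  "set_colimit _ \<I> S F Q c \<longleftrightarrow>
     set_cocone \<I> S F Q c \<and>
     (\<forall>(T :: 't set) t. set_cocone \<I> S F T t \<longrightarrow>
        (\<exists>!u. u \<in> Q \<rightarrow>\<^sub>E T \<and> (\<forall>i\<in>Obj \<I>. compose (S i) u (c i) = t i)))"

text \<open>The standard (co)limits: compatible families, and the quotient of the disjoint union by the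
  equivalence relation generated by \<open>(i, x) \<sim> (j, F a x)\<close> for arrows \<open>a : i \<rightarrow> j\<close>.\<close>

definition std_lim :: "('i, 'a) icat \<Rightarrow> ('i \<Rightarrow> 'x set) \<Rightarrow> ('a \<Rightarrow> 'x \<Rightarrow> 'x) \<Rightarrow> ('i \<Rightarrow> 'x) set" where
  "std_lim \<I> S F = {x \<in> (\<Pi>\<^sub>E i\<in>Obj \<I>. S i). \<forall>a\<in>Arr \<I>. F a (x (src \<I> a)) = x (tgt \<I> a)}"

definition std_proj ::
  "('i, 'a) icat \<Rightarrow> ('i \<Rightarrow> 'x set) \<Rightarrow> ('a \<Rightarrow> 'x \<Rightarrow> 'x) \<Rightarrow> 'i \<Rightarrow> ('i \<Rightarrow> 'x) \<Rightarrow> 'x" where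
  "std_proj \<I> S F i = (\<lambda>x\<in>std_lim \<I> S F. x i)"

definition glue ::
  "('i, 'a) icat \<Rightarrow> ('i \<Rightarrow> 'x set) \<Rightarrow> ('a \<Rightarrow> 'x \<Rightarrow> 'x) \<Rightarrow> (('i \<times> 'x) \<times> ('i \<times> 'x)) set" where
  "glue \<I> S F = {((src \<I> a, x), (tgt \<I> a, F a x)) | a x. a \<in> Arr \<I> \<and> x \<in> S (src \<I> a)}"

definition std_colim ::
  "('i, 'a) icat \<Rightarrow> ('i \<Rightarrow> 'x set) \<Rightarrow> ('a \<Rightarrow> 'x \<Rightarrow> 'x) \<Rightarrow> ('i \<times> 'x) set set" where
  "std_colim \<I> S F = (SIGMA i:Obj \<I>. S i) // (glue \<I> S F \<union> (glue \<I> S F)\<inverse>)\<^sup>*"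

definition std_coproj ::
  "('i, 'a) icat \<Rightarrow> ('i \<Rightarrow> 'x set) \<Rightarrow> ('a \<Rightarrow> 'x \<Rightarrow> 'x) \<Rightarrow> 'i \<Rightarrow> 'x \<Rightarrow> ('i \<times> 'x) set" where
  "std_coproj \<I> S F i = (\<lambda>x\<in>S i. (glue \<I> S F \<union> (glue \<I> S F)\<inverse>)\<^sup>* `` {(i, x)})"


section \<open>Limits and colimits of connectivity spaces\<close>

definition cnc_cone ::
  "cnc_category \<Rightarrow> ('i, 'a) icat \<Rightarrow> ('i \<Rightarrow> 'x cspace) \<Rightarrow> ('a \<Rightarrow> 'x \<Rightarrow> 'x) \<Rightarrow>
   'l cspace \<Rightarrow> ('i \<Rightarrow> 'l \<Rightarrow> 'x) \<Rightarrow> bool" where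
  "cnc_cone C \<I> D F L l \<longleftrightarrow>
     is_object C L \<and>
     (\<forall>i\<in>Obj \<I>. l i \<in> cmorphisms L (D i)) \<and>
     (\<forall>a\<in>Arr \<I>. compose (pts L) (F a) (l (src \<I> a)) = l (tgt \<I> a))"

definition cnc_limit ::
  "'t itself \<Rightarrow> cnc_category \<Rightarrow> ('i, 'a) icat \<Rightarrow> ('i \<Rightarrow> 'x cspace) \<Rightarrow> ('a \<Rightarrow> 'x \<Rightarrow> 'x) \<Rightarrow>
   'l cspace \<Rightarrow> ('i \<Rightarrow> 'l \<Rightarrow> 'x) \<Rightarrow> bool" where
  "cnc_limit _ C \<I> D F L l \<longleftrightarrow>
     cnc_cone C \<I> D F L l \<and>
     (\<forall>(T :: 't cspace) t. cnc_cone C \<I> D F T t \<longrightarrow>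
        (\<exists>!u. u \<in> cmorphisms T L \<and> (\<forall>i\<in>Obj \<I>. compose (pts T) (l i) u = t i)))"

definition cnc_cocone ::
  "cnc_category \<Rightarrow> ('i, 'a) icat \<Rightarrow> ('i \<Rightarrow> 'x cspace) \<Rightarrow> ('a \<Rightarrow> 'x \<Rightarrow> 'x) \<Rightarrow>
   'c cspace \<Rightarrow> ('i \<Rightarrow> 'x \<Rightarrow> 'c) \<Rightarrow> bool" where
  "cnc_cocone C \<I> D F Q c \<longleftrightarrow>
     is_object C Q \<and>
     (\<forall>i\<in>Obj \<I>. c i \<in> cmorphisms (D i) Q) \<and>
     (\<forall>a\<in>Arr \<I>. compose (pts (D (src \<I> a))) (c (tgt \<I> a)) (F a) = c (src \<I> a))"

definition cnc_colimit ::
  "'t itself \<Rightarrow> cnc_category \<Rightarrow> ('i, 'a) icat \<Rightarrow> ('i \<Rightarrow> 'x cspace) \<Rightarrow> ('a \<Rightarrow> 'x \<Rightarrow> 'x) \<Rightarrow>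
   'c cspace \<Rightarrow> ('i \<Rightarrow> 'x \<Rightarrow> 'c) \<Rightarrow> bool" where
  "cnc_colimit _ C \<I> D F Q c \<longleftrightarrow>
     cnc_cocone C \<I> D F Q c \<and>
     (\<forall>(T :: 't cspace) t. cnc_cocone C \<I> D F T t \<longrightarrow>
        (\<exists>!u. u \<in> cmorphisms Q T \<and> (\<forall>i\<in>Obj \<I>. compose (pts (D i)) u (c i) = t i)))"

definition colim_space ::
  "cnc_category \<Rightarrow> ('i, 'a) icat \<Rightarrow> ('i \<Rightarrow> 'x cspace) \<Rightarrow> 'c set \<Rightarrow> ('i \<Rightarrow> 'x \<Rightarrow> 'c) \<Rightarrow> 'c cspace" where
  "colim_space C \<I> D Q c =
     \<lparr>pts = Q,
      conn = (let \<A> = {c i ` K | i K. i \<in> Obj \<I> \<and> K \<in> conn (D i)}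
              in if C = Cnc then generated0 Q \<A> else generated Q \<A>)\<rparr>"

text \<open>Intersecting with \<^term>\<open>Pow L\<close> only matters when there are no objects, where the intersection
  over the empty family has to be the set of all subsets of \<open>L\<close>.\<close>

definition lim_space ::
  "('i, 'a) icat \<Rightarrow> ('i \<Rightarrow> 'x cspace) \<Rightarrow> 'l set \<Rightarrow> ('i \<Rightarrow> 'l \<Rightarrow> 'x) \<Rightarrow> 'l cspace" where
  "lim_space \<I> D L l =
     \<lparr>pts = L,
      conn = Pow L \<inter> (\<Inter>i\<in>Obj \<I>. {K. K \<subseteq> L \<and> l i ` K \<in> conn (D i)})\<rparr>"

end

theory Submission
  imports Defs
begin

text \<open>Subsets whose image under a map is connected form a connectivity structure. Hence the limit
  carrier with the intersection of these structures receives every set-theoretic factorisation of a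
  cone as a morphism; dually, pulling back the structure of a test space along the factorisation of
  a cocone gives a structure on the colimit carrier that contains the generators. For an arbitrary
  limit or colimit of finite sets, finiteness of the carrier comes from the projections being
  jointly injective and the coprojections jointly surjective.\<close>

section \<open>Pulling connectivity structures back along maps, and access to the object
  predicate\<close>

lemma connectivity_structure_preimage:
  assumes "connectivity_structure Y \<K>"
  shows "connectivity_structure X {A. A \<subseteq> X \<and> f ` A \<in> \<K>}"
  unfolding connectivity_structure_def
proof (intro conjI allI impI)
  show "{A. A \<subseteq> X \<and> f ` A \<in> \<K>} \<subseteq> Pow X" "{} \<in> {A. A \<subseteq> X \<and> f ` A \<in> \<K>}"
    using assms by (auto simp: connectivity_structure_def)
next
  fix \<J> assume J: "\<J> \<subseteq> {A. A \<subseteq> X \<and> f ` A \<in> \<K>}" "\<Inter>\<J> \<noteq> {}"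
  \<comment> \<open>A common point \<open>x\<close> of the family becomes the common point
    \<open>f x\<close> of the images, so closure of the target structure applies to them; taking
    images commutes with unions.\<close>
  then obtain x where "x \<in> \<Inter>\<J>" by blast
  then have "f x \<in> \<Inter>((`) f ` \<J>)" by blast
  moreover have "(`) f ` \<J> \<subseteq> \<K>" using J by blast
  ultimately have "\<Union>((`) f ` \<J>) \<in> \<K>"
    using assms unfolding connectivity_structure_def by blast
  then show "\<Union>\<J> \<in> {A. A \<subseteq> X \<and> f ` A \<in> \<K>}"
    using J by (auto simp: image_Union)
qed

text \<open>The image of \<open>{x}\<close> is \<open>{f x}\<close>, and this is connected because
  \<open>f\<close> takes \<open>X\<close> into \<open>Y\<close>.\<close>

lemma integral_connectivity_structure_preimage:
  assumes "integral_connectivity_structure Y \<K>" "f \<in> X \<rightarrow> Y"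
  shows "integral_connectivity_structure X {A. A \<subseteq> X \<and> f ` A \<in> \<K>}"
  using assms connectivity_structure_preimage[of Y \<K> X f]
  by (auto simp: integral_connectivity_structure_def)

lemma is_object_connectivity_structure:
  "is_object C X \<Longrightarrow> connectivity_structure (pts X) (conn X)"
  by (cases C) (auto simp: integral_connectivity_structure_def)

lemma is_object_integral:
  "is_object C X \<Longrightarrow> C \<noteq> Cnc \<Longrightarrow> integral_connectivity_structure (pts X) (conn X)"
  by (cases C) auto

lemma is_objectI:
  assumes "connectivity_structure (pts X) (conn X)"
    and "C \<noteq> Cnc \<Longrightarrow> integral_connectivity_structure (pts X) (conn X)"
    and "C = fCnct \<Longrightarrow> finite (pts X)"
  shows "is_object C X"
  using assms by (cases C) auto

lemma is_object_conn_subset: "is_object C X \<Longrightarrow> K \<in> conn X \<Longrightarrow> K \<subseteq> pts X"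
  using is_object_connectivity_structure[of C X] by (auto simp: connectivity_structure_def)

lemma cmorphisms_PiE: "f \<in> cmorphisms X Y \<Longrightarrow> f \<in> pts X \<rightarrow>\<^sub>E pts Y"
  by (simp add: cmorphisms_def)

text \<open>\<open>compose A g f\<close> is \<open>undefined\<close> off \<open>A\<close>, hence the
  inclusion; for connected sets it comes from \<open>is_object_conn_subset\<close>.\<close>

lemma image_compose: "K \<subseteq> A \<Longrightarrow> compose A g f ` K = g ` f ` K"
  by (force simp: compose_def)

lemma diagram_arrow:
  assumes "diagram C \<I> D F" "a \<in> Arr \<I>"
  shows "F a \<in> pts (D (src \<I> a)) \<rightarrow> pts (D (tgt \<I> a))"
  using assms cmorphisms_PiE[of "F a" "D (src \<I> a)" "D (tgt \<I> a)"]
  by (auto simp: diagram_def)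

lemma cnc_cone_set_cone: "cnc_cone C \<I> D F T t \<Longrightarrow> set_cone \<I> (carriers D) F (pts T) t"
  by (auto simp: cnc_cone_def set_cone_def dest: cmorphisms_PiE)

lemma cnc_cocone_set_cocone: "cnc_cocone C \<I> D F T t \<Longrightarrow> set_cocone \<I> (carriers D) F (pts T) t"
  by (auto simp: cnc_cocone_def set_cocone_def dest: cmorphisms_PiE)

section \<open>Limits\<close>

lemma set_limit_std_lim:
  assumes src_tgt: "\<And>a. a \<in> Arr \<I> \<Longrightarrow> src \<I> a \<in> Obj \<I> \<and> tgt \<I> a \<in> Obj \<I>"
  shows "set_limit TYPE('t) \<I> S F (std_lim \<I> S F) (std_proj \<I> S F)"
  unfolding set_limit_def
proof (intro conjI allI impI)
  show "set_cone \<I> S F (std_lim \<I> S F) (std_proj \<I> S F)"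
    by (auto simp: set_cone_def std_lim_def std_proj_def compose_def fun_eq_iff)
next
  fix T :: "'t set" and t
  assume T: "set_cone \<I> S F T t"
  \<comment> \<open>The coordinates are forced by the cone; both restrictions serve extensionality,
    the inner one of the families and the outer one of \<open>u\<close>.\<close>
  define u where "u = (\<lambda>y\<in>T. \<lambda>i\<in>Obj \<I>. t i y)"
  have t: "t i y \<in> S i" if "i \<in> Obj \<I>" "y \<in> T" for i y
    using T that by (auto simp: set_cone_def)
  have t_ext: "t i \<in> extensional T" if "i \<in> Obj \<I>" for i
    using T that by (auto simp: set_cone_def PiE_def)
  have t_nat: "F a (t (src \<I> a) y) = t (tgt \<I> a) y" if "a \<in> Arr \<I>" "y \<in> T" for a y
  proof -
    have "compose T (F a) (t (src \<I> a)) y = t (tgt \<I> a) y"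
      using T that by (simp add: set_cone_def)
    then show ?thesis using that by (simp add: compose_def)
  qed
  \<comment> \<open>Compatibility of \<open>u y\<close> along an arrow evaluates the restricted
    family at its source and target, which \<open>src_tgt\<close> places among the objects.\<close>
  have u: "u \<in> T \<rightarrow>\<^sub>E std_lim \<I> S F"
    using t t_nat src_tgt by (auto simp: u_def std_lim_def)
  show "\<exists>!u. u \<in> T \<rightarrow>\<^sub>E std_lim \<I> S F \<and> (\<forall>i\<in>Obj \<I>. compose T (std_proj \<I> S F i) u = t i)"
  proof (intro ex1I conjI ballI)
    show "u \<in> T \<rightarrow>\<^sub>E std_lim \<I> S F" by (fact u)
    show "compose T (std_proj \<I> S F i) u = t i" if i: "i \<in> Obj \<I>" for i
    proof (rule extensionalityI[OF compose_extensional t_ext[OF i]])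
      fix y assume y: "y \<in> T"
      with u have "u y \<in> std_lim \<I> S F" by blast
      then show "compose T (std_proj \<I> S F i) u y = t i y"
        using i y by (simp add: compose_def std_proj_def u_def)
    qed
  next
    fix v assume v: "v \<in> T \<rightarrow>\<^sub>E std_lim \<I> S F \<and> (\<forall>i\<in>Obj \<I>. compose T (std_proj \<I> S F i) v = t i)"
    show "v = u"
    proof (rule PiE_ext[of _ T "\<lambda>_. std_lim \<I> S F"])
      show "v \<in> T \<rightarrow>\<^sub>E std_lim \<I> S F" using v by blast
      show "u \<in> T \<rightarrow>\<^sub>E std_lim \<I> S F" by (fact u)
    next
      fix y assume y: "y \<in> T"
      then have vy: "v y \<in> std_lim \<I> S F" using v by blast
      have "v y i = t i y" if "i \<in> Obj \<I>" for i
      proof -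
        have "compose T (std_proj \<I> S F i) v y = t i y" using v that by simp
        then show ?thesis using y vy by (simp add: compose_def std_proj_def)
      qed
      moreover have "v y \<in> extensional (Obj \<I>)" using vy by (auto simp: std_lim_def PiE_def)
      ultimately show "v y = u y"
        using y by (intro extensionalityI[of _ "Obj \<I>"]) (auto simp: u_def)
    qed
  qed
qed

text \<open>Two points with equal projections are two factorisations of one cone on a one-point set,
  so uniqueness identifies them. The test set \<open>{x}\<close> lives in the carrier's own type,
  which is why universality is assumed at \<open>'l\<close>.\<close>

lemma set_limit_jointly_injective:
  assumes lim: "set_limit TYPE('l) \<I> S F (L :: 'l set) l"
    and xy: "x \<in> L" "y \<in> L" "\<And>i. i \<in> Obj \<I> \<Longrightarrow> l i x = l i y"
  shows "x = y"
proof -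
  have cone: "set_cone \<I> S F L l" using lim by (simp add: set_limit_def)
  define t where "t = (\<lambda>i. \<lambda>z\<in>{x}. l i z)"
  have nat: "F a (l (src \<I> a) x) = l (tgt \<I> a) x" if "a \<in> Arr \<I>" for a
  proof -
    have "compose L (F a) (l (src \<I> a)) x = l (tgt \<I> a) x"
      using cone that by (simp add: set_cone_def)
    then show ?thesis using xy by (simp add: compose_def)
  qed
  have "set_cone \<I> S F {x} t"
    using cone xy(1) nat
    by (auto simp: set_cone_def t_def compose_def fun_eq_iff)
  then have "\<exists>!u. u \<in> {x} \<rightarrow>\<^sub>E L \<and> (\<forall>i\<in>Obj \<I>. compose {x} (l i) u = t i)"
    using lim by (simp add: set_limit_def)
  moreover have "(\<lambda>z\<in>{x}. x) \<in> {x} \<rightarrow>\<^sub>E L \<and> (\<forall>i\<in>Obj \<I>. compose {x} (l i) (\<lambda>z\<in>{x}. x) = t i)"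
    using xy by (auto simp: t_def compose_def fun_eq_iff)
  moreover have "(\<lambda>z\<in>{x}. y) \<in> {x} \<rightarrow>\<^sub>E L \<and> (\<forall>i\<in>Obj \<I>. compose {x} (l i) (\<lambda>z\<in>{x}. y) = t i)"
    using xy by (auto simp: t_def compose_def fun_eq_iff)
  ultimately have "(\<lambda>z\<in>{x}. x) = (\<lambda>z\<in>{x}. y)" by blast
  from fun_cong[OF this, of x] show ?thesis by simp
qed

text \<open>Joint injectivity embeds \<open>L\<close> into a product of finitely many finite
  sets.\<close>

lemma finite_set_limit:
  assumes lim: "set_limit TYPE('l) \<I> S F (L :: 'l set) l"
    and fin: "finite (Obj \<I>)" "\<And>i. i \<in> Obj \<I> \<Longrightarrow> finite (S i)"
  shows "finite L"
proof (rule inj_on_finite)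
  let ?e = "\<lambda>x. \<lambda>i\<in>Obj \<I>. l i x"
  show "inj_on ?e L"
  proof (rule inj_onI)
    fix x y assume xy: "x \<in> L" "y \<in> L" "?e x = ?e y"
    then have "l i x = l i y" if "i \<in> Obj \<I>" for i
      using that by (metis restrict_apply)
    with xy show "x = y" using set_limit_jointly_injective[OF lim] by blast
  qed
  have "set_cone \<I> S F L l" using lim by (simp add: set_limit_def)
  then show "?e ` L \<subseteq> (\<Pi>\<^sub>E i\<in>Obj \<I>. S i)" by (fastforce simp: set_cone_def)
  show "finite (\<Pi>\<^sub>E i\<in>Obj \<I>. S i)" using fin by (rule finite_PiE)
qed

section \<open>Limits of connectivity spaces\<close>

lemma is_object_lim_space:
  assumes D: "\<And>i. i \<in> Obj \<I> \<Longrightarrow> is_object C (D i)"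
    and cone: "set_cone \<I> (carriers D) F L l"
    and fin: "C = fCnct \<Longrightarrow> finite L"
  shows "is_object C (lim_space \<I> D L l)"
proof -
  let ?\<P> = "\<lambda>i. {K. K \<subseteq> L \<and> l i ` K \<in> conn (D i)}"
  \<comment> \<open>Counting \<open>Pow L\<close> as a member keeps the intersected family nonempty
    even without objects, as \<open>connectivity_structure_Inter\<close> demands.\<close>
  let ?\<K> = "\<Inter>(insert (Pow L) (?\<P> ` Obj \<I>))"
  have conn: "conn (lim_space \<I> D L l) = ?\<K>" and pts: "pts (lim_space \<I> D L l) = L"
    by (simp_all add: lim_space_def)
  have str: "connectivity_structure L ?\<K>"
    using D connectivity_structure_Pow
    by (intro connectivity_structure_Inter)
      (auto intro: connectivity_structure_preimage is_object_connectivity_structure)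
  have sing: "{x} \<in> ?\<K>" if "C \<noteq> Cnc" "x \<in> L" for x
  proof -
    have "l i x \<in> pts (D i)" if "i \<in> Obj \<I>" for i
      using cone that \<open>x \<in> L\<close> by (auto simp: set_cone_def)
    then show ?thesis
      using D is_object_integral[OF _ \<open>C \<noteq> Cnc\<close>] \<open>x \<in> L\<close>
      by (auto simp: integral_connectivity_structure_def)
  qed
  show ?thesis
    using str sing fin
    by (cases C) (simp_all add: conn pts integral_connectivity_structure_def del: Inter_insert)
qed

lemma cnc_limit_lim_space:
  assumes D: "\<And>i. i \<in> Obj \<I> \<Longrightarrow> is_object C (D i)"
    and lim: "set_limit TYPE('t) \<I> (carriers D) F L l"
    and fin: "C = fCnct \<Longrightarrow> finite L"
  shows "cnc_limit TYPE('t) C \<I> D F (lim_space \<I> D L l) l"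
  unfolding cnc_limit_def
proof (intro conjI allI impI)
  have cone: "set_cone \<I> (carriers D) F L l" using lim by (simp add: set_limit_def)
  then show "cnc_cone C \<I> D F (lim_space \<I> D L l) l"
    using is_object_lim_space[OF D cone fin]
    by (auto simp: cnc_cone_def set_cone_def cmorphisms_def lim_space_def)
next
  fix T :: "'t cspace" and t
  assume T: "cnc_cone C \<I> D F T t"
  \<comment> \<open>A set is connected in the limit when all its projections are; projecting
    \<open>u\<close> K\<open>gives\<close>t i \<open>K\<close>, connected since the legs of the cone
    are morphisms.\<close>
  have morphism: "u \<in> cmorphisms T (lim_space \<I> D L l)"
    if u: "u \<in> pts T \<rightarrow>\<^sub>E L" "\<forall>i\<in>Obj \<I>. compose (pts T) (l i) u = t i" for u
    unfolding cmorphisms_def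
  proof (intro CollectI conjI ballI)
    show "u \<in> pts T \<rightarrow>\<^sub>E pts (lim_space \<I> D L l)" using u by (simp add: lim_space_def)
    fix K assume K: "K \<in> conn T"
    then have KT: "K \<subseteq> pts T"
      using T is_object_conn_subset by (auto simp: cnc_cone_def)
    have "l i ` u ` K \<in> conn (D i)" if "i \<in> Obj \<I>" for i
    proof -
      have "l i ` u ` K = t i ` K"
        using image_compose[OF KT, of "l i" u] u that by simp
      then show ?thesis using T K that by (auto simp: cnc_cone_def cmorphisms_def)
    qed
    moreover have "u ` K \<subseteq> L" using u KT by blast
    ultimately show "u ` K \<in> conn (lim_space \<I> D L l)" by (auto simp: lim_space_def)
  qed
  have "\<exists>!u. u \<in> pts T \<rightarrow>\<^sub>E L \<and> (\<forall>i\<in>Obj \<I>. compose (pts T) (l i) u = t i)"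
    using lim cnc_cone_set_cone[OF T] by (simp add: set_limit_def)
  \<comment> \<open>The two conditions on \<open>u\<close> agree, so existence and uniqueness
    transfer from sets in one rewrite.\<close>
  moreover have "u \<in> cmorphisms T (lim_space \<I> D L l) \<and> (\<forall>i\<in>Obj \<I>. compose (pts T) (l i) u = t i) \<longleftrightarrow>
      u \<in> pts T \<rightarrow>\<^sub>E L \<and> (\<forall>i\<in>Obj \<I>. compose (pts T) (l i) u = t i)" for u
    using morphism[of u] cmorphisms_PiE[of u T "lim_space \<I> D L l"] by (auto simp: lim_space_def)
  ultimately show "\<exists>!u. u \<in> cmorphisms T (lim_space \<I> D L l) \<and>
      (\<forall>i\<in>Obj \<I>. compose (pts T) (l i) u = t i)"
    by simp
qed

section \<open>Colimits\<close>

lemma set_colimit_std_colim: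
  assumes F: "\<And>a. a \<in> Arr \<I> \<Longrightarrow> F a \<in> S (src \<I> a) \<rightarrow> S (tgt \<I> a)"
  shows "set_colimit TYPE('t) \<I> S F (std_colim \<I> S F) (std_coproj \<I> S F)"
  unfolding set_colimit_def
proof (intro conjI allI impI)
  let ?Q = "std_colim \<I> S F" and ?c = "std_coproj \<I> S F"
  \<comment> \<open>The closure is reflexive at every pair of the type, hence an equivalence on
    \<open>UNIV\<close>, and equality of classes needs no membership conditions.\<close>
  define R where "R = (glue \<I> S F \<union> (glue \<I> S F)\<inverse>)\<^sup>*"
  have "equiv UNIV R"
    unfolding R_def equiv_def by (simp add: refl_rtrancl sym_rtrancl sym_Un_converse trans_rtrancl)
  then have class_eq: "R `` {p} = R `` {q}" if "(p, q) \<in> R" for p q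
    using that by (rule equiv_class_eq)
  have c: "?c i x = R `` {(i, x)}" if "x \<in> S i" for i x
    using that by (simp add: std_coproj_def R_def)
  have c_in: "?c i \<in> S i \<rightarrow>\<^sub>E ?Q" if "i \<in> Obj \<I>" for i
    using that by (auto simp: std_coproj_def std_colim_def intro: quotientI)
  have c_surj: "\<exists>i\<in>Obj \<I>. \<exists>x\<in>S i. q = ?c i x" if "q \<in> ?Q" for q
    using that c by (fastforce simp: std_colim_def R_def elim!: quotientE)
  show "set_cocone \<I> S F ?Q ?c"
    unfolding set_cocone_def
  proof (intro conjI ballI)
    show "?c i \<in> S i \<rightarrow>\<^sub>E ?Q" if "i \<in> Obj \<I>" for i using c_in[OF that] .
    fix a assume a: "a \<in> Arr \<I>"
    show "compose (S (src \<I> a)) (?c (tgt \<I> a)) (F a) = ?c (src \<I> a)"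
    proof (rule extensionalityI[OF compose_extensional])
      show "?c (src \<I> a) \<in> extensional (S (src \<I> a))" by (simp add: std_coproj_def)
      fix x assume x: "x \<in> S (src \<I> a)"
      have "((src \<I> a, x), (tgt \<I> a, F a x)) \<in> R"
        using a x by (auto simp: R_def glue_def)
      moreover have "F a x \<in> S (tgt \<I> a)" using F[OF a] x by blast
      ultimately show "compose (S (src \<I> a)) (?c (tgt \<I> a)) (F a) x = ?c (src \<I> a) x"
        using x class_eq by (simp add: compose_def c)
    qed
  qed
  fix T :: "'t set" and t
  assume T: "set_cocone \<I> S F T t"
  have t: "t i \<in> S i \<rightarrow>\<^sub>E T" if "i \<in> Obj \<I>" for i
    using T that by (simp add: set_cocone_def)
  have t_nat: "t (tgt \<I> a) (F a x) = t (src \<I> a) x" if "a \<in> Arr \<I>" "x \<in> S (src \<I> a)" for a x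
  proof -
    have "compose (S (src \<I> a)) (t (tgt \<I> a)) (F a) x = t (src \<I> a) x"
      using T that by (simp add: set_cocone_def)
    then show ?thesis using that by (simp add: compose_def)
  qed
  \<comment> \<open>Induction along a zigzag of gluing steps: \<open>t_nat\<close> handles each
    step, in either direction.\<close>
  have t_R: "t (fst p) (snd p) = t (fst q) (snd q)" if "(p, q) \<in> R" for p q
    using that unfolding R_def
    by (induction rule: rtrancl_induct) (auto simp: glue_def t_nat)
  \<comment> \<open>The cocone evaluated at an arbitrary representative; by \<open>t_R\<close> the
    choice does not affect the value.\<close>
  define u where "u = (\<lambda>q\<in>?Q. let p = SOME p. p \<in> q in t (fst p) (snd p))"
  have u_c: "u (?c i x) = t i x" if "i \<in> Obj \<I>" "x \<in> S i" for i x
  proof -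
    have "(i, x) \<in> ?c i x" using that by (simp add: c R_def)
    then have "(SOME p. p \<in> ?c i x) \<in> ?c i x" by (rule someI)
    then have "((i, x), SOME p. p \<in> ?c i x) \<in> R" using that by (simp add: c)
    from t_R[OF this] show ?thesis
      using c_in[OF that(1)] that by (auto simp: u_def Let_def)
  qed
  have u: "u \<in> ?Q \<rightarrow>\<^sub>E T"
  proof (rule PiE_I)
    fix q assume "q \<in> ?Q"
    then obtain i x where ix: "i \<in> Obj \<I>" "x \<in> S i" "q = ?c i x" using c_surj by blast
    then show "u q \<in> T" using u_c t by fastforce
  qed (simp add: u_def)
  show "\<exists>!u. u \<in> ?Q \<rightarrow>\<^sub>E T \<and> (\<forall>i\<in>Obj \<I>. compose (S i) u (?c i) = t i)"
  proof (intro ex1I conjI ballI)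
    show "u \<in> ?Q \<rightarrow>\<^sub>E T" by (fact u)
    show "compose (S i) u (?c i) = t i" if i: "i \<in> Obj \<I>" for i
    proof (rule extensionalityI[OF compose_extensional])
      show "t i \<in> extensional (S i)" using t[OF i] by (simp add: PiE_def)
    qed (simp add: compose_def u_c i)
  next
    fix v assume v: "v \<in> ?Q \<rightarrow>\<^sub>E T \<and> (\<forall>i\<in>Obj \<I>. compose (S i) v (?c i) = t i)"
    show "v = u"
    proof (rule PiE_ext[of _ ?Q "\<lambda>_. T"])
      show "v \<in> ?Q \<rightarrow>\<^sub>E T" using v by blast
      show "u \<in> ?Q \<rightarrow>\<^sub>E T" by (fact u)
    next
      fix q assume "q \<in> ?Q"
      then obtain i x where ix: "i \<in> Obj \<I>" "x \<in> S i" "q = ?c i x" using c_surj by blast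
      then have "compose (S i) v (?c i) x = t i x" using v by simp
      then show "v q = u q" using ix u_c by (simp add: compose_def)
    qed
  qed
qed

text \<open>A point missed by every coprojection could be moved without disturbing the cocone,
  against uniqueness. Both test sets, \<open>Q\<close> and \<open>Q - {q}\<close>, lie in the type
  \<open>'c\<close>.\<close>

lemma set_colimit_jointly_surjective:
  assumes colim: "set_colimit TYPE('c) \<I> S F (Q :: 'c set) c"
    and q: "q \<in> Q"
  shows "\<exists>i\<in>Obj \<I>. q \<in> c i ` S i"
proof (rule ccontr)
  assume "\<not> ?thesis"
  then have q_notin: "c i x \<noteq> q" if "i \<in> Obj \<I>" "x \<in> S i" for i x using that by blast
  have cocone: "set_cocone \<I> S F Q c" using colim by (simp add: set_colimit_def)
  then have c: "c i \<in> S i \<rightarrow>\<^sub>E Q" if "i \<in> Obj \<I>" for i using that by (simp add: set_cocone_def)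
  have factor: "\<exists>!u. u \<in> Q \<rightarrow>\<^sub>E T \<and> (\<forall>i\<in>Obj \<I>. compose (S i) u (c i) = t i)"
    if "set_cocone \<I> S F T t" for T :: "'c set" and t
    using colim that by (simp add: set_colimit_def)
  have "set_cocone \<I> S F (Q - {q}) c"
    using cocone c q_notin by (auto simp: set_cocone_def PiE_iff)
  \<comment> \<open>Moving \<open>q\<close> needs a second point of \<open>Q\<close>. Factoring
    through the cocone on \<open>Q - {q}\<close> supplies \<open>r q\<close>, and excludes the case
    where \<open>q\<close> is the only point.\<close>
  then obtain r where "r \<in> Q \<rightarrow>\<^sub>E Q - {q}" using factor by blast
  then have q': "r q \<in> Q" "r q \<noteq> q" using q by auto
  \<comment> \<open>Used twice below: \<open>y = q\<close> gives the identity,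
    \<open>y = r q\<close> the map that moves only \<open>q\<close>. Both factor the cocone
    \<open>c\<close> through itself.\<close>
  have fixes_c: "compose (S i) (\<lambda>x\<in>Q. if x = q then y else x) (c i) = c i"
    if i: "i \<in> Obj \<I>" for i y
  proof (rule extensionalityI[OF compose_extensional])
    show "c i \<in> extensional (S i)" using c[OF i] by (simp add: PiE_def)
    fix x assume "x \<in> S i"
    then show "compose (S i) (\<lambda>x\<in>Q. if x = q then y else x) (c i) x = c i x"
      using c[OF i] q_notin[OF i] by (auto simp: compose_def)
  qed
  have "(\<lambda>x\<in>Q. if x = q then y else x) \<in> Q \<rightarrow>\<^sub>E Q" if "y \<in> Q" for y
    using that by auto
  then have "(\<lambda>x\<in>Q. if x = q then q else x) = (\<lambda>x\<in>Q. if x = q then r q else x)"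
    using factor[OF cocone] fixes_c q q' by blast
  from fun_cong[OF this, of q] show False using q q' by simp
qed

text \<open>Joint surjectivity covers \<open>Q\<close> by finitely many finite images.\<close>

lemma finite_set_colimit:
  assumes colim: "set_colimit TYPE('c) \<I> S F (Q :: 'c set) c"
    and fin: "finite (Obj \<I>)" "\<And>i. i \<in> Obj \<I> \<Longrightarrow> finite (S i)"
  shows "finite Q"
proof (rule finite_subset)
  show "Q \<subseteq> (\<Union>i\<in>Obj \<I>. c i ` S i)"
    using set_colimit_jointly_surjective[OF colim] by blast
  show "finite (\<Union>i\<in>Obj \<I>. c i ` S i)" using fin by blast
qed

section \<open>Colimits of connectivity spaces\<close>

lemma cnc_colimit_colim_space:
  assumes D: "\<And>i. i \<in> Obj \<I> \<Longrightarrow> is_object C (D i)"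
    and colim: "set_colimit TYPE('t) \<I> (carriers D) F Q c"
    and fin: "C = fCnct \<Longrightarrow> finite Q"
  shows "cnc_colimit TYPE('t) C \<I> D F (colim_space C \<I> D Q c) c"
  unfolding cnc_colimit_def
proof (intro conjI allI impI)
  define \<A> where "\<A> = {c i ` K | i K. i \<in> Obj \<I> \<and> K \<in> conn (D i)}"
  let ?Q = "colim_space C \<I> D Q c"
  have pts: "pts ?Q = Q"
    and conn: "conn ?Q = (if C = Cnc then generated0 Q \<A> else generated Q \<A>)"
    by (simp_all add: colim_space_def \<A>_def Let_def)
  have cocone: "set_cocone \<I> (carriers D) F Q c" using colim by (simp add: set_colimit_def)
  then have c: "c i \<in> pts (D i) \<rightarrow>\<^sub>E Q" if "i \<in> Obj \<I>" for i
    using that by (simp add: set_cocone_def)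
  \<comment> \<open>The \<open>LEAST\<close> terms are only known to denote generated structures
    once the generators are subsets of \<open>Q\<close>.\<close>
  have A: "\<A> \<subseteq> Pow Q"
  proof
    fix B assume "B \<in> \<A>"
    then obtain i K where iK: "i \<in> Obj \<I>" "K \<in> conn (D i)" "B = c i ` K" by (auto simp: \<A>_def)
    then have "K \<subseteq> pts (D i)" using D is_object_conn_subset by blast
    then show "B \<in> Pow Q" using c iK by fastforce
  qed
  have A_conn: "\<A> \<subseteq> conn ?Q" using generated0_least(2)[OF A] generated_least(2)[OF A] conn by simp
  have "connectivity_structure (pts ?Q) (conn ?Q)"
    and "C \<noteq> Cnc \<Longrightarrow> integral_connectivity_structure (pts ?Q) (conn ?Q)"
    and "C = fCnct \<Longrightarrow> finite (pts ?Q)"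
    using generated0_least(1)[OF A] generated_least(1)[OF A] fin unfolding pts conn
    by (auto simp: integral_connectivity_structure_def)
  then have "is_object C ?Q" by (rule is_objectI)
  moreover have "c i \<in> cmorphisms (D i) ?Q" if "i \<in> Obj \<I>" for i
    using c[OF that] A_conn that by (auto simp: cmorphisms_def pts \<A>_def)
  ultimately show "cnc_cocone C \<I> D F ?Q c"
    using cocone by (simp add: cnc_cocone_def set_cocone_def)
  fix T :: "'t cspace" and t
  assume T: "cnc_cocone C \<I> D F T t"
  then have TC: "is_object C T" by (simp add: cnc_cocone_def)
  have morphism: "u \<in> cmorphisms ?Q T"
    if u: "u \<in> Q \<rightarrow>\<^sub>E pts T" "\<forall>i\<in>Obj \<I>. compose (pts (D i)) u (c i) = t i" for u
  proof -
    \<comment> \<open>By minimality it suffices that this pulled-back structure contains the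
      generators: on \<open>c i\<close> K\<open>the map\<close>u\<open>has image\<close>t i
      \<open>K\<close>, which is connected in \<open>T\<close>.\<close>
    let ?\<P> = "{K. K \<subseteq> Q \<and> u ` K \<in> conn T}"
    have "\<A> \<subseteq> ?\<P>"
    proof
      fix B assume B: "B \<in> \<A>"
      then obtain i K where iK: "i \<in> Obj \<I>" "K \<in> conn (D i)" "B = c i ` K" by (auto simp: \<A>_def)
      then have "K \<subseteq> pts (D i)" using D is_object_conn_subset by blast
      then have "u ` B = t i ` K" using image_compose[of K "pts (D i)" u "c i"] u iK by simp
      also have "\<dots> \<in> conn T" using T iK by (auto simp: cnc_cocone_def cmorphisms_def)
      finally show "B \<in> ?\<P>" using A B by auto
    qed
    moreover have "connectivity_structure Q ?\<P>"
      using is_object_connectivity_structure[OF TC] by (rule connectivity_structure_preimage)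
    \<comment> \<open>Outside \<open>Cnc\<close> minimality ranges over integral structures only, so
      the pullback has to be integral as well; this uses integrality of \<open>T\<close>.\<close>
    moreover have "integral_connectivity_structure Q ?\<P>" if "C \<noteq> Cnc"
      using is_object_integral[OF TC that] u
      by (intro integral_connectivity_structure_preimage) (auto simp: PiE_def)
    ultimately have "conn ?Q \<subseteq> ?\<P>"
      using generated0_least(3)[OF A] generated_least(3)[OF A] by (simp add: conn)
    then show ?thesis using u by (auto simp: cmorphisms_def pts)
  qed
  have "\<exists>!u. u \<in> Q \<rightarrow>\<^sub>E pts T \<and> (\<forall>i\<in>Obj \<I>. compose (pts (D i)) u (c i) = t i)"
    using colim cnc_cocone_set_cocone[OF T] by (simp add: set_colimit_def)
  moreover have "u \<in> cmorphisms ?Q T \<and> (\<forall>i\<in>Obj \<I>. compose (pts (D i)) u (c i) = t i) \<longleftrightarrow>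
      u \<in> Q \<rightarrow>\<^sub>E pts T \<and> (\<forall>i\<in>Obj \<I>. compose (pts (D i)) u (c i) = t i)" for u
    using morphism[of u] cmorphisms_PiE[of u ?Q T] by (auto simp: pts)
  ultimately show "\<exists>!u. u \<in> cmorphisms ?Q T \<and> (\<forall>i\<in>Obj \<I>. compose (pts (D i)) u (c i) = t i)"
    by simp
qed

section \<open>The three categories\<close>

text \<open>For an arbitrary set-level limit or colimit, universality is assumed at two test types:
  at \<open>'t\<close> to obtain the factorisations, and at the type of the carrier itself to derive
  finiteness in the case of \<open>fCnct\<close>.\<close>

theorem mainTheorem2:
  fixes C :: cnc_category
    and \<I> :: "('i, 'a) icat"
    and D :: "'i \<Rightarrow> 'x cspace"
    and F :: "'a \<Rightarrow> 'x \<Rightarrow> 'x"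
  assumes "small_category \<I>"
    and "C = fCnct \<longrightarrow> finite_category \<I>"
    and "diagram C \<I> D F"
  shows
    "(set_colimit TYPE('t) \<I> (carriers D) F
        (std_colim \<I> (carriers D) F) (std_coproj \<I> (carriers D) F) \<and>
      cnc_colimit TYPE('t) C \<I> D F
        (colim_space C \<I> D (std_colim \<I> (carriers D) F) (std_coproj \<I> (carriers D) F))
        (std_coproj \<I> (carriers D) F) \<and>
      (\<forall>(Q :: 'c set) c.
         set_colimit TYPE('t) \<I> (carriers D) F Q c \<and>
         set_colimit TYPE('c) \<I> (carriers D) F Q c \<longrightarrow>
         cnc_colimit TYPE('t) C \<I> D F (colim_space C \<I> D Q c) c)) \<and>
     (set_limit TYPE('t) \<I> (carriers D) F
        (std_lim \<I> (carriers D) F) (std_proj \<I> (carriers D) F) \<and>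
      cnc_limit TYPE('t) C \<I> D F
        (lim_space \<I> D (std_lim \<I> (carriers D) F) (std_proj \<I> (carriers D) F))
        (std_proj \<I> (carriers D) F) \<and>
      (\<forall>(L :: 'l set) l.
         set_limit TYPE('t) \<I> (carriers D) F L l \<and>
         set_limit TYPE('l) \<I> (carriers D) F L l \<longrightarrow>
         cnc_limit TYPE('t) C \<I> D F (lim_space \<I> D L l) l))"
proof -
  have src_tgt: "src \<I> a \<in> Obj \<I> \<and> tgt \<I> a \<in> Obj \<I>" if "a \<in> Arr \<I>" for a
    using assms(1) that by (simp add: small_category_def)
  have D: "is_object C (D i)" if "i \<in> Obj \<I>" for i
    using assms(3) that by (simp add: diagram_def)
  have fin: "finite (Obj \<I>)" "\<And>i. i \<in> Obj \<I> \<Longrightarrow> finite (pts (D i))" if "C = fCnct"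
    using assms(2) D that by (auto simp: finite_category_def)
  \<comment> \<open>\<open>'z\<close> is free in the context, so this fact and the next hold at
    every test type: at \<open>'t\<close> for universality, and at the type of the standard carrier
    for finiteness.\<close>
  have std_colim: "set_colimit TYPE('z) \<I> (carriers D) F
      (std_colim \<I> (carriers D) F) (std_coproj \<I> (carriers D) F)"
    by (rule set_colimit_std_colim) (rule diagram_arrow[OF assms(3)])
  have std_lim: "set_limit TYPE('z) \<I> (carriers D) F
      (std_lim \<I> (carriers D) F) (std_proj \<I> (carriers D) F)"
    by (rule set_limit_std_lim) (rule src_tgt)
  show ?thesis
  proof (intro conjI allI impI)
    show "cnc_colimit TYPE('t) C \<I> D F
        (colim_space C \<I> D (std_colim \<I> (carriers D) F) (std_coproj \<I> (carriers D) F))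
        (std_coproj \<I> (carriers D) F)"
      using cnc_colimit_colim_space[OF D std_colim] finite_set_colimit[OF std_colim] fin by blast
    show "cnc_limit TYPE('t) C \<I> D F
        (lim_space \<I> D (std_lim \<I> (carriers D) F) (std_proj \<I> (carriers D) F))
        (std_proj \<I> (carriers D) F)"
      using cnc_limit_lim_space[OF D std_lim] finite_set_limit[OF std_lim] fin by blast
  next
    fix Q :: "'c set" and c
    assume "set_colimit TYPE('t) \<I> (carriers D) F Q c \<and> set_colimit TYPE('c) \<I> (carriers D) F Q c"
    then show "cnc_colimit TYPE('t) C \<I> D F (colim_space C \<I> D Q c) c"
      using cnc_colimit_colim_space[of \<I> C D F Q c] D finite_set_colimit[of \<I> "carriers D" F Q c] fin
      by blast
  next
    fix L :: "'l set" and l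
    assume "set_limit TYPE('t) \<I> (carriers D) F L l \<and> set_limit TYPE('l) \<I> (carriers D) F L l"
    then show "cnc_limit TYPE('t) C \<I> D F (lim_space \<I> D L l) l"
      using cnc_limit_lim_space[of \<I> C D F L l] D finite_set_limit[of \<I> "carriers D" F L l] fin
      by blast
  qed (rule std_colim std_lim; assumption)+
qed

end
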